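(* Let $\mathcal G$ be a Lie algebra, $\rho:\mathcal G\to gl(V)$ a representation of $\mathcal G$ and $\rho^*:\mathcal G\to gl(V^* )$ its dual representation. Suppose that $T:V\to\mathcal G$ is an $\mathcal O$-operator associated to $\rho$. Then $$r=T+T^{21}$$ is a symmetric solution of the $S$-equation in the left-symmetric algebra $T(V)\ltimes_{\rho^*,0}V^*$. Here $T(V)\subset\mathcal G$ carries the left-symmetric product $T(u)\cdot T(v)=T(\rho(T(u))v)$ ($u,v\in V$), $T$ is identified with the element $\sum_iT(v_i)\otimes v_i^*\in T(V)\otimes V^*$ for a basis $\{v_i\}$ of $V$ with dual basis $\{v_i^*\}$, and $T^{21}=\sum_iv_i^*\otimes T(v_i)$.
   Context: All vector spaces and algebras are finite-dimensional over a field $\mathbf F$. A left-symmetric algebra is a vector space $A$ with a bilinear product satisfying $(xy)z-x(yz)=(yx)z-y(xz)$; then $[x,y]=xy-yx$ is a Lie bracket on $A$. $\mathcal O$-operator associated to $\rho$: a linear map $T:V\to\mathcal G$ with $[T(u),T(v)]=T(\rho(T(u))v-\rho(T(v))u)$ for all $u,v\in V$. In this case the product $T(u)\cdot T(v)=T(\rho(T(u))v)$ is well defined and left-symmetric on $T(V)$, with commutator the Lie bracket of $\mathcal G$. The dual representation is $\langle\rho^*(x)u^*,v\rangle=-\langle u^*,\rho(x)v\rangle$. $T(V)\ltimes_{\rho^*,0}V^*$ is the left-symmetric algebra on $T(V)\oplus V^*$ with product $(x+u^* )*(y+w^* )=x\cdot y+\rho^*(x)w^*$ for $x,y\in T(V)$,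 $u^*,w^*\in V^*$. $S$-equation in a left-symmetric algebra $A$ for $r=\sum_ia_i\otimes b_i\in A\otimes A$: $-r_{12}\cdot r_{13}+r_{12}\cdot r_{23}+[r_{13},r_{23}]=0$, i.e. $\sum_{i,j}\big(-a_i a_j\otimes b_i\otimes b_j+a_i\otimes b_i a_j\otimes b_j+a_i\otimes a_j\otimes[b_i,b_j]\big)=0$ in $A^{\otimes3}$. Symmetric means invariant under the flip of $A\otimes A$. *)

theory Defs
  imports
    Complex_Main
    "HOL-Library.Poly_Mapping"
    "HOL-Library.Product_Plus"
    "HOL-Library.Function_Algebras"
    "HOL-Library.Set_Algebras"
begin

section \<open>Lie algebras, representations, left-symmetric algebras\<close>

locale lie_algebra = vector_space scale
  for scale :: "'f::field \<Rightarrow> 'g::ab_group_add \<Rightarrow> 'g" +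
  fixes bracket :: "'g \<Rightarrow> 'g \<Rightarrow> 'g"
  assumes finite_dim: "\<exists>S. finite S \<and> span S = UNIV"
    and linear_bracket_left: "Vector_Spaces.linear scale scale (\<lambda>x. bracket x y)"
    and linear_bracket_right: "Vector_Spaces.linear scale scale (\<lambda>y. bracket x y)"
    and bracket_self: "bracket x x = 0"
    and jacobi:
      "bracket x (bracket y z) + bracket y (bracket z x) + bracket z (bracket x y) = 0"

locale lie_representation =
  lie_algebra scaleG bracket + V: vector_space scaleV
  for scaleG :: "'f::field \<Rightarrow> 'g::ab_group_add \<Rightarrow> 'g"
    and bracket :: "'g \<Rightarrow> 'g \<Rightarrow> 'g"
    and scaleV :: "'f \<Rightarrow> 'v::ab_group_add \<Rightarrow> 'v" +
  fixes \<rho> :: "'g \<Rightarrow> 'v \<Rightarrow> 'v"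
  assumes linear_endo: "Vector_Spaces.linear scaleV scaleV (\<rho> x)"
    and linear_rep: "Vector_Spaces.linear scaleG scaleV (\<lambda>x. \<rho> x v)"
    and rep_bracket: "\<rho> (bracket x y) v = \<rho> x (\<rho> y v) - \<rho> y (\<rho> x v)"

locale O_operator = lie_representation scaleG bracket scaleV \<rho>
  for scaleG :: "'f::field \<Rightarrow> 'g::ab_group_add \<Rightarrow> 'g"
    and bracket :: "'g \<Rightarrow> 'g \<Rightarrow> 'g"
    and scaleV :: "'f \<Rightarrow> 'v::ab_group_add \<Rightarrow> 'v"
    and \<rho> :: "'g \<Rightarrow> 'v \<Rightarrow> 'v" +
  fixes T :: "'v \<Rightarrow> 'g"
  assumes linear_T: "Vector_Spaces.linear scaleV scaleG T"
    and O_identity: "bracket (T u) (T v) = T (\<rho> (T u) v - \<rho> (T v) u)"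

text \<open>The underlying space of a left-symmetric algebra is a subspace \<open>A\<close> of an ambient vector
  space, because \<open>T(V)\<close> and the dual space are not whole types.\<close>

locale left_symmetric_algebra = vector_space scale
  for scale :: "'f::field \<Rightarrow> 'a::ab_group_add \<Rightarrow> 'a" +
  fixes A :: "'a set" and mult :: "'a \<Rightarrow> 'a \<Rightarrow> 'a"
  assumes finite_dim: "\<exists>S. finite S \<and> span S = A"
    and mult_closed: "x \<in> A \<Longrightarrow> y \<in> A \<Longrightarrow> mult x y \<in> A"
    and mult_add_left:
      "x \<in> A \<Longrightarrow> y \<in> A \<Longrightarrow> z \<in> A \<Longrightarrow> mult (x + y) z = mult x z + mult y z"
    and mult_add_right:
      "x \<in> A \<Longrightarrow> y \<in> A \<Longrightarrow> z \<in> A \<Longrightarrow> mult x (y + z) = mult x y + mult x z"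
    and mult_scale_left: "x \<in> A \<Longrightarrow> y \<in> A \<Longrightarrow> mult (scale c x) y = scale c (mult x y)"
    and mult_scale_right: "x \<in> A \<Longrightarrow> y \<in> A \<Longrightarrow> mult x (scale c y) = scale c (mult x y)"
    and left_symmetric:
      "x \<in> A \<Longrightarrow> y \<in> A \<Longrightarrow> z \<in> A \<Longrightarrow>
        mult (mult x y) z - mult x (mult y z) = mult (mult y x) z - mult y (mult x z)"


section \<open>Tensor powers\<close>

text \<open>The \<open>n\<close>-th tensor power of a subspace \<open>A\<close> is the free vector space on the \<open>n\<close>-tuples of
  elements of \<open>A\<close> (lists of length \<open>n\<close>), modulo the span of the multilinearity relators.
  Its elements are cosets; their sum is the sum of sets from \<open>Set_Algebras\<close>, and its zero is
  the coset of \<open>0\<close> (not the zero \<open>{0}\<close> of that theory).\<close>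

abbreviation monomial :: "'a list \<Rightarrow> 'a list \<Rightarrow>\<^sub>0 'f::field" where
  "monomial xs \<equiv> Poly_Mapping.single xs 1"

definition free_scale :: "'f::field \<Rightarrow> ('a list \<Rightarrow>\<^sub>0 'f) \<Rightarrow> ('a list \<Rightarrow>\<^sub>0 'f)" where
  "free_scale c = Poly_Mapping.map ((*) c)"

definition tensor_relations ::
    "('f::field \<Rightarrow> 'a::ab_group_add \<Rightarrow> 'a) \<Rightarrow> 'a set \<Rightarrow> nat \<Rightarrow> ('a list \<Rightarrow>\<^sub>0 'f) set" where
  "tensor_relations scale A n = module.span free_scale
    ({monomial (xs[i := x + y]) - monomial (xs[i := x]) - monomial (xs[i := y]) | xs i x y.
        length xs = n \<and> set xs \<subseteq> A \<and> i < n \<and> x \<in> A \<and> y \<in> A} \<union>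
     {monomial (xs[i := scale c x]) - free_scale c (monomial (xs[i := x])) | xs i c x.
        length xs = n \<and> set xs \<subseteq> A \<and> i < n \<and> x \<in> A})"

definition tensor_class ::
    "('f::field \<Rightarrow> 'a::ab_group_add \<Rightarrow> 'a) \<Rightarrow> 'a set \<Rightarrow> nat \<Rightarrow> ('a list \<Rightarrow>\<^sub>0 'f) \<Rightarrow> ('a list \<Rightarrow>\<^sub>0 'f) set"
  where "tensor_class scale A n p = p +o tensor_relations scale A n"

definition tensor_power ::
    "('f::field \<Rightarrow> 'a::ab_group_add \<Rightarrow> 'a) \<Rightarrow> 'a set \<Rightarrow> nat \<Rightarrow> ('a list \<Rightarrow>\<^sub>0 'f) set set" where
  "tensor_power scale A n =
    tensor_class scale A n ` {p. Poly_Mapping.keys p \<subseteq> {xs. length xs = n \<and> set xs \<subseteq> A}}"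

text \<open>The flip \<open>a \<otimes> b \<mapsto> b \<otimes> a\<close>, acting on cosets elementwise.\<close>

definition tensor_flip :: "('a list \<Rightarrow>\<^sub>0 'f::field) set \<Rightarrow> ('a list \<Rightarrow>\<^sub>0 'f) set" where
  "tensor_flip t = Poly_Mapping.map_key rev ` t"


section \<open>The S-equation\<close>

text \<open>A formal sum of \<open>a\<^sub>i \<otimes> b\<^sub>i\<close> is given by the list of the pairs \<open>(a\<^sub>i, b\<^sub>i)\<close>. Every element
  of the tensor square is of this form, as coefficients can be absorbed into the \<open>a\<^sub>i\<close>.\<close>

definition formal_sum :: "('a \<times> 'a) list \<Rightarrow> 'a list \<Rightarrow>\<^sub>0 'f::field" where
  "formal_sum ps = (\<Sum>(a, b)\<leftarrow>ps. monomial [a, b])"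

definition S_expression ::
    "('a::ab_group_add \<Rightarrow> 'a \<Rightarrow> 'a) \<Rightarrow> ('a \<times> 'a) list \<Rightarrow> 'a list \<Rightarrow>\<^sub>0 'f::field" where
  "S_expression mult ps = (\<Sum>(a, b)\<leftarrow>ps. \<Sum>(a', b')\<leftarrow>ps.
     - monomial [mult a a', b, b'] + monomial [a, mult b a', b']
     + monomial [a, a', mult b b' - mult b' b])"

text \<open>Since the expression is written in terms of a presentation of the tensor, the equation is
  required for all presentations.\<close>

definition S_equation ::
    "('f::field \<Rightarrow> 'a::ab_group_add \<Rightarrow> 'a) \<Rightarrow> 'a set \<Rightarrow> ('a \<Rightarrow> 'a \<Rightarrow> 'a) \<Rightarrow>
     ('a list \<Rightarrow>\<^sub>0 'f) set \<Rightarrow> bool" where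
  "S_equation scale A mult r \<longleftrightarrow>
     r \<in> tensor_power scale A 2 \<and>
     (\<forall>ps. set ps \<subseteq> A \<times> A \<and> r = tensor_class scale A 2 (formal_sum ps) \<longrightarrow>
        tensor_class scale A 3 (S_expression mult ps) = tensor_class scale A 3 0)"


section \<open>The left-symmetric algebra attached to an O-operator\<close>

text \<open>The product \<open>T(u) \<cdot> T(v) = T(\<rho>(T(u)) v)\<close> on \<open>T(V)\<close>.\<close>

definition O_product :: "('g \<Rightarrow> 'v \<Rightarrow> 'v) \<Rightarrow> ('v \<Rightarrow> 'g) \<Rightarrow> 'g \<Rightarrow> 'g \<Rightarrow> 'g" where
  "O_product \<rho> T x y = (THE z. \<exists>u v. x = T u \<and> y = T v \<and> z = T (\<rho> (T u) v))"

lemma (in O_operator) O_product_eq: "O_product \<rho> T (T u) (T v) = T (\<rho> (T u) v)"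
proof -
  interpret T: Vector_Spaces.linear scaleV scaleG T by (rule linear_T)
  have bracket0: "bracket x 0 = 0" for x
  proof -
    interpret b: Vector_Spaces.linear scaleG scaleG "\<lambda>y. bracket x y"
      by (rule linear_bracket_right)
    show ?thesis by (rule b.zero)
  qed
  have rho_zero: "\<rho> 0 w = 0" for w
  proof -
    interpret r: Vector_Spaces.linear scaleG scaleV "\<lambda>x. \<rho> x w" by (rule linear_rep)
    show ?thesis by (rule r.zero)
  qed
  have "T (\<rho> (T u') v') = T (\<rho> (T u) v)" if "T u = T u'" "T v = T v'" for u' v'
  proof -
    interpret r: Vector_Spaces.linear scaleV scaleV "\<rho> (T u)" by (rule linear_endo)
    have "T (v' - v) = 0" using that by (simp add: T.diff)
    then have "T (\<rho> (T u) (v' - v)) = 0"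
      using O_identity[of u "v' - v"] by (simp add: bracket0 rho_zero)
    then have "T (\<rho> (T u) v') = T (\<rho> (T u) v)" by (simp add: T.diff r.diff)
    then show ?thesis using that by simp
  qed
  then show ?thesis
    unfolding O_product_def by (intro the_equality) blast+
qed

definition dual_space :: "('f::field \<Rightarrow> 'v::ab_group_add \<Rightarrow> 'v) \<Rightarrow> ('v \<Rightarrow> 'f) set" where
  "dual_space scaleV = {f. Vector_Spaces.linear scaleV (*) f}"

definition dual_rep :: "('g \<Rightarrow> 'v \<Rightarrow> 'v) \<Rightarrow> 'g \<Rightarrow> ('v \<Rightarrow> 'f::field) \<Rightarrow> ('v \<Rightarrow> 'f)" where
  "dual_rep \<rho> x f = (\<lambda>v. - f (\<rho> x v))"

definition semidirect_scale ::
    "('f::field \<Rightarrow> 'g \<Rightarrow> 'g) \<Rightarrow> 'f \<Rightarrow> 'g \<times> ('v \<Rightarrow> 'f) \<Rightarrow> 'g \<times> ('v \<Rightarrow> 'f)" where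
  "semidirect_scale scaleG c = (\<lambda>(x, f). (scaleG c x, \<lambda>v. c * f v))"

definition semidirect_carrier ::
    "('f::field \<Rightarrow> 'v::ab_group_add \<Rightarrow> 'v) \<Rightarrow> ('v \<Rightarrow> 'g) \<Rightarrow> ('g \<times> ('v \<Rightarrow> 'f)) set" where
  "semidirect_carrier scaleV T = range T \<times> dual_space scaleV"

definition semidirect_mult ::
    "('g \<Rightarrow> 'v \<Rightarrow> 'v) \<Rightarrow> ('v \<Rightarrow> 'g) \<Rightarrow> 'g \<times> ('v \<Rightarrow> 'f::field) \<Rightarrow> 'g \<times> ('v \<Rightarrow> 'f) \<Rightarrow> 'g \<times> ('v \<Rightarrow> 'f)"
  where
  "semidirect_mult \<rho> T = (\<lambda>(x, f) (y, h). (O_product \<rho> T x y, dual_rep \<rho> x h))"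

text \<open>The member of the dual basis of \<open>B\<close> that belongs to \<open>b \<in> B\<close>: the \<open>b\<close>-coordinate.\<close>

definition dual_vector ::
    "('f::field \<Rightarrow> 'v::ab_group_add \<Rightarrow> 'v) \<Rightarrow> 'v set \<Rightarrow> 'v \<Rightarrow> ('v \<Rightarrow> 'f)" where
  "dual_vector scaleV B b = (\<lambda>v. module.representation scaleV B v b)"

definition operator_tensor ::
    "('f::field \<Rightarrow> 'g::ab_group_add \<Rightarrow> 'g) \<Rightarrow> ('f \<Rightarrow> 'v::ab_group_add \<Rightarrow> 'v) \<Rightarrow> 'v set \<Rightarrow> ('v \<Rightarrow> 'g) \<Rightarrow>
     (('g \<times> ('v \<Rightarrow> 'f)) list \<Rightarrow>\<^sub>0 'f) set" where
  "operator_tensor scaleG scaleV B T =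
    tensor_class (semidirect_scale scaleG) (semidirect_carrier scaleV T) 2
      (\<Sum>b\<in>B. monomial [(T b, 0), (0, dual_vector scaleV B b)])"

end

theory Submission
  imports Defs
begin

text \<open>
  A formal combination of tuples vanishes in a tensor power iff every multilinear form kills it,
  so all identities between tensors can be checked by evaluating multilinear forms.
  The S-expression is quadratic in the tensor, hence independent of its presentation, and may be
  computed from the presentation of \<open>T + T\<^sup>2\<^sup>1\<close> by dual bases. There, the terms with a vanishing
  factor drop out, and the identity
  \<open>\<Sum>b. b \<otimes> \<rho>\<^sup>*(x) b\<^sup>* = - \<Sum>b. \<rho>(x) b \<otimes> b\<^sup>*\<close> moves \<open>\<rho>\<^sup>*\<close> from the dual vectors to the
  arguments of \<open>T\<close>, after which the remaining terms cancel in each of the positions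
  \<open>(T, *, *)\<close>, \<open>(*, T, *)\<close>, \<open>(*, *, T)\<close>.
\<close>

section \<open>Linear functionals on the free vector space over tuples\<close>

lemma lookup_free_scale [simp]:
  "Poly_Mapping.lookup (free_scale c p) k = c * Poly_Mapping.lookup p k"
  by (simp add: free_scale_def Poly_Mapping.map.rep_eq when_def)

interpretation free: vector_space "free_scale :: 'f::field \<Rightarrow> ('a list \<Rightarrow>\<^sub>0 'f) \<Rightarrow> _"
  by unfold_locales (auto intro!: poly_mapping_eqI simp: lookup_add algebra_simps)

lemma vector_space_field: "vector_space ((*) :: 'f::field \<Rightarrow> 'f \<Rightarrow> 'f)"
  by unfold_locales (simp_all add: algebra_simps)

text \<open>The unique linear functional on the free space with prescribed values on the
  monomials.\<close>

definition linear_extension :: "('a list \<Rightarrow> 'f::field) \<Rightarrow> ('a list \<Rightarrow>\<^sub>0 'f) \<Rightarrow> 'f" where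
  "linear_extension g p = (\<Sum>k\<in>Poly_Mapping.keys p. Poly_Mapping.lookup p k * g k)"

text \<open>Keys outside the support carry coefficient 0. A common index set for several elements
  turns additivity and homogeneity into termwise identities.\<close>

lemma linear_extension_superset:
  assumes "finite K" "Poly_Mapping.keys p \<subseteq> K"
  shows "linear_extension g p = (\<Sum>k\<in>K. Poly_Mapping.lookup p k * g k)"
  unfolding linear_extension_def
  by (rule sum.mono_neutral_left) (use assms in \<open>auto simp: in_keys_iff\<close>)

lemma linear_linear_extension:
  fixes g :: "'a list \<Rightarrow> 'f::field"
  shows "Vector_Spaces.linear free_scale (*) (linear_extension g)"
proof (unfold Vector_Spaces.linear_iff, intro conjI allI)
  show "vector_space (free_scale :: 'f \<Rightarrow> ('a list \<Rightarrow>\<^sub>0 'f) \<Rightarrow> _)" ..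
  show "vector_space ((*) :: 'f \<Rightarrow> 'f \<Rightarrow> 'f)" by (rule vector_space_field)
next
  fix p q :: "'a list \<Rightarrow>\<^sub>0 'f"
  show "linear_extension g (p + q) = linear_extension g p + linear_extension g q"
  proof -
    let ?K = "Poly_Mapping.keys p \<union> Poly_Mapping.keys q"
    have "Poly_Mapping.keys (p + q) \<subseteq> ?K" by (rule Poly_Mapping.keys_add)
    then show ?thesis
      by (simp add: linear_extension_superset[of ?K] lookup_add algebra_simps sum.distrib)
  qed
next
  fix c :: 'f and p :: "'a list \<Rightarrow>\<^sub>0 'f"
  have "Poly_Mapping.keys (free_scale c p) \<subseteq> Poly_Mapping.keys p"
    by (auto simp: in_keys_iff)
  then show "linear_extension g (free_scale c p) = c * linear_extension g p"
    by (simp add: linear_extension_superset[of "Poly_Mapping.keys p"] sum_distrib_left mult.assoc)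
qed

lemma linear_extension_simps:
  fixes g :: "'a list \<Rightarrow> 'f::field"
  shows linear_extension_zero: "linear_extension g 0 = 0"
    and linear_extension_add: "linear_extension g (p + q) = linear_extension g p + linear_extension g q"
    and linear_extension_diff: "linear_extension g (p - q) = linear_extension g p - linear_extension g q"
    and linear_extension_uminus: "linear_extension g (- p) = - linear_extension g p"
    and linear_extension_scale: "linear_extension g (free_scale c p) = c * linear_extension g p"
proof -
  interpret g: Vector_Spaces.linear free_scale "(*)" "linear_extension g"
    by (rule linear_linear_extension)
  show "linear_extension g 0 = 0" by (rule g.zero)
  show "linear_extension g (p + q) = linear_extension g p + linear_extension g q" by (rule g.add)
  show "linear_extension g (p - q) = linear_extension g p - linear_extension g q" by (rule g.diff)
  show "linear_extension g (- p) = - linear_extension g p" by (rule g.neg)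
  show "linear_extension g (free_scale c p) = c * linear_extension g p" by (rule g.scale)
qed

lemma linear_extension_monomial [simp]: "linear_extension g (monomial xs) = g xs"
  by (simp add: linear_extension_def)

lemma linear_extension_sum_list:
  "linear_extension g (sum_list ps) = (\<Sum>p\<leftarrow>ps. linear_extension g p)"
  by (induction ps) (simp_all add: linear_extension_add linear_extension_zero)

text \<open>Each element is the combination of its monomials, so a functional is determined by its
  values on them. Hence functionals on the free space and functions on tuples are
  interchangeable.\<close>

lemma linear_functional_eq_linear_extension:
  assumes "Vector_Spaces.linear free_scale (*) L"
  shows "L p = linear_extension (\<lambda>xs. L (monomial xs)) p"
proof -
  interpret L: Vector_Spaces.linear free_scale "(*)" L by fact
  have "p = (\<Sum>k\<in>Poly_Mapping.keys p. free_scale (Poly_Mapping.lookup p k) (monomial k))"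
    by (rule poly_mapping_eqI)
      (auto simp: lookup_sum lookup_single when_def in_keys_iff if_distrib sum.delta' cong: if_cong)
  then have "L p = L (\<Sum>k\<in>Poly_Mapping.keys p. free_scale (Poly_Mapping.lookup p k) (monomial k))"
    by (rule arg_cong)
  then show ?thesis
    by (simp add: L.sum L.scale linear_extension_def)
qed

lemma map_key_rev_monomial: "Poly_Mapping.map_key rev (monomial xs) = monomial (rev xs)"
  using inj_on_rev[of UNIV] map_key_single[of rev "rev xs" 1] by simp

lemma linear_extension_map_key_rev:
  fixes g :: "'a list \<Rightarrow> 'f::field"
  shows "linear_extension g (Poly_Mapping.map_key rev p) = linear_extension (\<lambda>xs. g (rev xs)) p"
proof -
  have lookup_rev: "Poly_Mapping.lookup (Poly_Mapping.map_key rev p) k = Poly_Mapping.lookup p (rev k)"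
    for p :: "'a list \<Rightarrow>\<^sub>0 'f" and k
    using inj_on_rev[of UNIV] by (simp add: map_key.rep_eq)
  \<comment> \<open>Once the left side is known to be linear in \<open>p\<close>, it is determined
    by its values on monomials, where reversal is explicit.\<close>
  have "Vector_Spaces.linear free_scale (*) (\<lambda>p. linear_extension g (Poly_Mapping.map_key rev p))"
    unfolding Vector_Spaces.linear_iff
  proof (intro conjI allI)
    fix p q :: "'a list \<Rightarrow>\<^sub>0 'f"  and c
    have "Poly_Mapping.map_key rev (p + q) =
        Poly_Mapping.map_key rev p + Poly_Mapping.map_key rev q"
      by (rule poly_mapping_eqI) (simp add: lookup_rev lookup_add)
    then show "linear_extension g (Poly_Mapping.map_key rev (p + q)) =
        linear_extension g (Poly_Mapping.map_key rev p) +
        linear_extension g (Poly_Mapping.map_key rev q)"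
      by (simp add: linear_extension_add)
    have "Poly_Mapping.map_key rev (free_scale c p) = free_scale c (Poly_Mapping.map_key rev p)"
      by (rule poly_mapping_eqI) (simp add: lookup_rev)
    then show "linear_extension g (Poly_Mapping.map_key rev (free_scale c p)) =
        c * linear_extension g (Poly_Mapping.map_key rev p)"
      by (simp add: linear_extension_scale)
  qed (rule free.vector_space_axioms vector_space_field)+
  from linear_functional_eq_linear_extension[OF this, of p] show ?thesis
    by (simp add: map_key_rev_monomial)
qed

section \<open>Duality between tensor relations and multilinear forms\<close>

lemma (in vector_space) separating_functional:
  assumes "subspace S" "x \<notin> S"
  obtains f where "Vector_Spaces.linear scale (*) f" "\<And>s. s \<in> S \<Longrightarrow> f s = 0" "f x = 1"
proof -
  interpret P: vector_space_pair scale "(*) :: 'a \<Rightarrow> 'a \<Rightarrow> 'a"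
    by (intro vector_space_pair.intro vector_space_axioms vector_space_field)
  obtain C where C: "C \<subseteq> S" "independent C" "S \<subseteq> span C"
    by (rule maximal_independent_subset)
  with assms have "span C = S" by (simp add: span_minimal subset_antisym)
  with assms have x: "x \<notin> span C" by simp
  \<comment> \<open>Since \<open>x\<close> lies outside \<open>span C\<close>, which is
    \<open>S\<close>, adjoining it to the basis \<open>C\<close> keeps independence. The functional
    is prescribed as 0 on \<open>C\<close> and 1 at \<open>x\<close>.\<close>
  with C have "independent (insert x C)" by (simp add: independent_insertI)
  then obtain f where f: "Vector_Spaces.linear scale (*) f"
    "\<forall>y\<in>insert x C. f y = (if y = x then 1 else 0)"
    using P.linear_independent_extend[of "insert x C" "\<lambda>y. if y = x then 1 else 0"] by blast
  have "x \<notin> C" using x span_base by blast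
  with f(2) have 0: "\<And>y. y \<in> C \<Longrightarrow> f y = 0" by auto
  have "f s = 0" if "s \<in> S" for s
    using P.linear_eq_0_on_span[OF f(1) 0] that \<open>span C = S\<close> by blast
  with f show ?thesis using that by auto
qed

text \<open>The conditions mirror the generators of \<open>tensor_relations\<close>: a form is a
  function whose linear extension kills all relators. Tuples of another length or with entries
  outside \<open>A\<close> are not constrained.\<close>

definition multilinear_form ::
    "('f::field \<Rightarrow> 'a::ab_group_add \<Rightarrow> 'a) \<Rightarrow> 'a set \<Rightarrow> nat \<Rightarrow> ('a list \<Rightarrow> 'f) \<Rightarrow> bool" where
  "multilinear_form scale A n g \<longleftrightarrow>
    (\<forall>xs i x. length xs = n \<and> set xs \<subseteq> A \<and> i < n \<and> x \<in> A \<longrightarrow>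
      (\<forall>y\<in>A. g (xs[i := x + y]) = g (xs[i := x]) + g (xs[i := y])) \<and>
      (\<forall>c. g (xs[i := scale c x]) = c * g (xs[i := x])))"

text \<open>A linear extension that kills the relators kills their span. Conversely, a functional
  \<open>L\<close> that separates \<open>p\<close> from the relations restricts on monomials to a
  multilinear form, because \<open>L\<close> kills the relators; the linear extension of this form
  is \<open>L\<close> itself, which is 1 at \<open>p\<close>.\<close>

lemma tensor_relations_iff:
  "p \<in> tensor_relations scale A n \<longleftrightarrow>
    (\<forall>g. multilinear_form scale A n g \<longrightarrow> linear_extension g p = 0)"
proof (intro iffI allI impI)
  fix g assume "p \<in> tensor_relations scale A n" and g: "multilinear_form scale A n g"
  then show "linear_extension g p = 0"
    unfolding tensor_relations_def
    by (elim module_hom.eq_0_on_span[OF linear_linear_extension[THEN Vector_Spaces.linear.axioms(3)], rotated])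
      (auto simp: multilinear_form_def linear_extension_diff linear_extension_scale)
next
  assume *: "\<forall>g. multilinear_form scale A n g \<longrightarrow> linear_extension g p = 0"
  show "p \<in> tensor_relations scale A n"
  proof (rule ccontr)
    assume "p \<notin> tensor_relations scale A n"
    then obtain L where L: "Vector_Spaces.linear free_scale (*) L"
      and L0: "\<And>q. q \<in> tensor_relations scale A n \<Longrightarrow> L q = 0" and "L p = 1"
      using free.separating_functional[of "tensor_relations scale A n" p]
      unfolding tensor_relations_def by (metis (no_types, lifting) free.subspace_span)
    interpret L: Vector_Spaces.linear free_scale "(*)" L by fact
    have "multilinear_form scale A n (\<lambda>xs. L (monomial xs))"
      unfolding multilinear_form_def
    proof (intro allI impI conjI ballI)
      fix xs i x y assume "length xs = n \<and> set xs \<subseteq> A \<and> i < n \<and> x \<in> A" "y \<in> A"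
      then have "monomial (xs[i := x + y]) - monomial (xs[i := x]) - monomial (xs[i := y])
          \<in> tensor_relations scale A n"
        unfolding tensor_relations_def by (intro free.span_base) blast
      from L0[OF this] show "L (monomial (xs[i := x + y])) =
          L (monomial (xs[i := x])) + L (monomial (xs[i := y]))"
        by (simp add: L.diff L.add diff_diff_eq)
    next
      fix xs i x c assume "length xs = n \<and> set xs \<subseteq> A \<and> i < n \<and> x \<in> A"
      then have "monomial (xs[i := scale c x]) - free_scale c (monomial (xs[i := x]))
          \<in> tensor_relations scale A n"
        unfolding tensor_relations_def by (intro free.span_base) blast
      from L0[OF this] show "L (monomial (xs[i := scale c x])) = c * L (monomial (xs[i := x]))"
        by (simp add: L.diff L.scale)
    qed
    with * have "L p = 0" by (simp add: linear_functional_eq_linear_extension[OF L, of p])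
    with \<open>L p = 1\<close> show False by simp
  qed
qed

section \<open>Tensor classes: equality, sum and flip\<close>

lemma zero_in_tensor_relations: "0 \<in> tensor_relations scale A n"
  by (simp add: tensor_relations_iff linear_extension_zero)

lemma tensor_relations_add:
  "p \<in> tensor_relations scale A n \<Longrightarrow> q \<in> tensor_relations scale A n \<Longrightarrow>
    p + q \<in> tensor_relations scale A n"
  by (simp add: tensor_relations_iff linear_extension_add)

lemma tensor_class_eq_diff:
  "tensor_class scale A n p = {q. q - p \<in> tensor_relations scale A n}"
  unfolding tensor_class_def by (force simp: elt_set_plus_def)

text \<open>Cosets agree iff the difference of their representatives is a relation, and relations
  are detected by forms. This is the test by which tensor identities are checked from here
  on.\<close>

lemma tensor_class_eq_iff:
  "tensor_class scale A n p = tensor_class scale A n q \<longleftrightarrow>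
    (\<forall>g. multilinear_form scale A n g \<longrightarrow> linear_extension g p = linear_extension g q)"
proof
  assume "tensor_class scale A n p = tensor_class scale A n q"
  moreover have "p \<in> tensor_class scale A n p"
    by (simp add: tensor_class_eq_diff zero_in_tensor_relations)
  ultimately have "p - q \<in> tensor_relations scale A n" by (simp add: tensor_class_eq_diff)
  then show "\<forall>g. multilinear_form scale A n g \<longrightarrow> linear_extension g p = linear_extension g q"
    by (simp add: tensor_relations_iff linear_extension_diff)
next
  assume "\<forall>g. multilinear_form scale A n g \<longrightarrow> linear_extension g p = linear_extension g q"
  then show "tensor_class scale A n p = tensor_class scale A n q"
    by (auto simp: tensor_class_eq_diff tensor_relations_iff linear_extension_diff)
qed

text \<open>The sum on the left is the elementwise sum of sets. One inclusion is closure of the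
  relations under addition; the other splits \<open>x\<close> as \<open>(x - q) + q\<close>.\<close>

lemma tensor_class_add:
  "tensor_class scale A n p + tensor_class scale A n q = tensor_class scale A n (p + q)"
proof -
  show ?thesis
  proof (intro set_eqI iffI)
    fix x assume "x \<in> tensor_class scale A n p + tensor_class scale A n q"
    then obtain y z where "x = y + z" "y - p \<in> tensor_relations scale A n"
      "z - q \<in> tensor_relations scale A n"
      by (auto simp: tensor_class_eq_diff elim: set_plus_elim)
    with tensor_relations_add[of "y - p" scale A n "z - q"] show "x \<in> tensor_class scale A n (p + q)"
      by (simp add: tensor_class_eq_diff algebra_simps)
  next
    fix x assume "x \<in> tensor_class scale A n (p + q)"
    then have "x - q \<in> tensor_class scale A n p" "q \<in> tensor_class scale A n q"
      by (simp_all add: tensor_class_eq_diff zero_in_tensor_relations diff_diff_eq add.commute)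
    then have "(x - q) + q \<in> tensor_class scale A n p + tensor_class scale A n q"
      by (rule set_plus_intro)
    then show "x \<in> tensor_class scale A n p + tensor_class scale A n q" by simp
  qed
qed

lemma multilinear_form_rev:
  assumes "multilinear_form scale A n g"
  shows "multilinear_form scale A n (\<lambda>xs. g (rev xs))"
  unfolding multilinear_form_def
proof (intro allI impI)
  fix xs i x assume "length xs = n \<and> set xs \<subseteq> A \<and> i < n \<and> x \<in> A"
  \<comment> \<open>Replacing entry \<open>i\<close> and then reversing is the same as replacing
    entry \<open>n - i - 1\<close> of the reversed tuple.\<close>
  moreover from this have "length (rev xs) = n \<and> set (rev xs) \<subseteq> A \<and> n - i - 1 < n \<and> x \<in> A"
    by auto
  ultimately show "(\<forall>y\<in>A. g (rev (xs[i := x + y])) = g (rev (xs[i := x])) + g (rev (xs[i := y]))) \<and>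
      (\<forall>c. g (rev (xs[i := scale c x])) = c * g (rev (xs[i := x])))"
    using assms unfolding multilinear_form_def by (simp add: rev_update)
qed

lemma map_key_rev_rev: "Poly_Mapping.map_key rev (Poly_Mapping.map_key rev p) = p"
  using inj_on_rev[of UNIV] by (simp add: map_key_compose o_def map_key_id)

lemma map_key_rev_diff:
  "Poly_Mapping.map_key rev (p - q) = Poly_Mapping.map_key rev p - Poly_Mapping.map_key rev q"
  using inj_on_rev[of UNIV] by (intro poly_mapping_eqI) (simp add: map_key.rep_eq lookup_minus)

lemma map_key_rev_in_tensor_relations:
  "p \<in> tensor_relations scale A n \<Longrightarrow> Poly_Mapping.map_key rev p \<in> tensor_relations scale A n"
  by (simp add: tensor_relations_iff linear_extension_map_key_rev multilinear_form_rev)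

text \<open>Reversal is additive and preserves the relations, so it maps a coset into a coset. Being
  an involution, it supplies its own preimages, so the whole coset is reached.\<close>

lemma tensor_flip_tensor_class:
  "tensor_flip (tensor_class scale A n p) = tensor_class scale A n (Poly_Mapping.map_key rev p)"
  unfolding tensor_flip_def tensor_class_eq_diff
proof (intro set_eqI iffI)
  fix q assume "q \<in> {q. q - Poly_Mapping.map_key rev p \<in> tensor_relations scale A n}"
  then have "Poly_Mapping.map_key rev q - p \<in> tensor_relations scale A n"
    using map_key_rev_in_tensor_relations[of "q - Poly_Mapping.map_key rev p" scale A n]
    by (simp add: map_key_rev_diff map_key_rev_rev)
  then show "q \<in> Poly_Mapping.map_key rev ` {q. q - p \<in> tensor_relations scale A n}"
    by (intro image_eqI[of _ _ "Poly_Mapping.map_key rev q"]) (simp_all add: map_key_rev_rev)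
qed (auto simp: map_key_rev_in_tensor_relations simp flip: map_key_rev_diff)

section \<open>Forms of degree two and three on explicit lists\<close>

lemma multilinear_form_2I:
  assumes "\<And>x x' y. x \<in> A \<Longrightarrow> x' \<in> A \<Longrightarrow> y \<in> A \<Longrightarrow> h (x + x') y = h x y + h x' y"
    and "\<And>x y y'. x \<in> A \<Longrightarrow> y \<in> A \<Longrightarrow> y' \<in> A \<Longrightarrow> h x (y + y') = h x y + h x y'"
    and "\<And>c x y. x \<in> A \<Longrightarrow> y \<in> A \<Longrightarrow> h (scale c x) y = c * h x y"
    and "\<And>c x y. x \<in> A \<Longrightarrow> y \<in> A \<Longrightarrow> h x (scale c y) = c * h x y"
  shows "multilinear_form scale A 2 (\<lambda>xs. h (xs ! 0) (xs ! 1))"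
  unfolding multilinear_form_def
  using assms
  by (auto simp: numeral_2_eq_2 length_Suc_conv less_Suc_eq)

context
  fixes scale :: "'f::field \<Rightarrow> 'a::ab_group_add \<Rightarrow> 'a" and A g
  assumes g: "multilinear_form scale A 3 g"
begin

lemma trilinear_add:
  assumes "x \<in> A" "y \<in> A" "z \<in> A" "w \<in> A"
  shows "g [x + w, y, z] = g [x, y, z] + g [w, y, z]"
    and "g [x, y + w, z] = g [x, y, z] + g [x, w, z]"
    and "g [x, y, z + w] = g [x, y, z] + g [x, y, w]"
proof -
  have *: "g ([x, y, z][i := u + w]) = g ([x, y, z][i := u]) + g ([x, y, z][i := w])"
    if "i < 3" "u \<in> A" for i u
    using g[unfolded multilinear_form_def, THEN spec, THEN spec, THEN spec, of "[x, y, z]" i u]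
      that assms by (simp del: list_update.simps)
  show "g [x + w, y, z] = g [x, y, z] + g [w, y, z]" using *[of 0 x] assms by simp
  show "g [x, y + w, z] = g [x, y, z] + g [x, w, z]" using *[of 1 y] assms by simp
  show "g [x, y, z + w] = g [x, y, z] + g [x, y, w]" using *[of 2 z] assms
    by (simp add: numeral_2_eq_2)
qed

lemma trilinear_scale:
  assumes "x \<in> A" "y \<in> A" "z \<in> A"
  shows "g [scale c x, y, z] = c * g [x, y, z]"
    and "g [x, scale c y, z] = c * g [x, y, z]"
    and "g [x, y, scale c z] = c * g [x, y, z]"
proof -
  have *: "g ([x, y, z][i := scale c u]) = c * g ([x, y, z][i := u])"
    if "i < 3" "u \<in> A" for i u
    using g[unfolded multilinear_form_def, THEN spec, THEN spec, THEN spec, of "[x, y, z]" i u]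
      that assms by (simp del: list_update.simps)
  show "g [scale c x, y, z] = c * g [x, y, z]" using *[of 0 x] assms by simp
  show "g [x, scale c y, z] = c * g [x, y, z]" using *[of 1 y] assms by simp
  show "g [x, y, scale c z] = c * g [x, y, z]" using *[of 2 z] assms
    by (simp add: numeral_2_eq_2)
qed

end

section \<open>The S-expression as a double sum over a presentation\<close>

lemma sum_list_swap:
  fixes f :: "'a \<Rightarrow> 'b \<Rightarrow> 'c::comm_monoid_add"
  shows "(\<Sum>x\<leftarrow>xs. \<Sum>y\<leftarrow>ys. f x y) = (\<Sum>y\<leftarrow>ys. \<Sum>x\<leftarrow>xs. f x y)"
  by (induction xs) (simp_all add: sum_list_addf)

lemma keys_formal_sum:
  "Poly_Mapping.keys (formal_sum ps :: 'a list \<Rightarrow>\<^sub>0 'f::field) \<subseteq> (\<lambda>(a, b). [a, b]) ` set ps"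
proof (induction ps)
  case (Cons p ps)
  have "formal_sum (p # ps) = monomial [fst p, snd p] + (formal_sum ps :: 'a list \<Rightarrow>\<^sub>0 'f)"
    by (simp add: formal_sum_def case_prod_unfold)
  then show ?case
    using Cons keys_add[of "monomial [fst p, snd p]" "formal_sum ps :: 'a list \<Rightarrow>\<^sub>0 'f"]
    by (auto simp: case_prod_unfold)
qed (simp add: formal_sum_def)

lemma linear_extension_formal_sum:
  "linear_extension h (formal_sum ps) = (\<Sum>(a, b)\<leftarrow>ps. h [a, b])"
  by (simp add: formal_sum_def linear_extension_sum_list case_prod_unfold o_def)

text \<open>The value under \<open>g\<close> of the summand of the S-expression that belongs to an
  ordered pair of terms of the presentation. Grouping the arguments into two pairs allows one term
  to be frozen while the other varies.\<close>

definition S_form :: "('a::ab_group_add \<Rightarrow> 'a \<Rightarrow> 'a) \<Rightarrow> ('a list \<Rightarrow> 'f::field) \<Rightarrow> 'a \<times> 'a \<Rightarrow> 'a \<times> 'a \<Rightarrow> 'f"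
  where "S_form mult g = (\<lambda>(a, b) (a', b').
    - g [mult a a', b, b'] + g [a, mult b a', b'] + g [a, a', mult b b' - mult b' b])"

lemma linear_extension_S_expression:
  "linear_extension g (S_expression mult ps) = (\<Sum>p\<leftarrow>ps. \<Sum>q\<leftarrow>ps. S_form mult g p q)"
  by (simp add: S_expression_def S_form_def linear_extension_sum_list case_prod_unfold o_def
      linear_extension_add linear_extension_uminus linear_extension_diff)

section \<open>Independence of the S-expression from the presentation\<close>

context left_symmetric_algebra
begin

lemma subspace_carrier: "subspace A"
  using finite_dim subspace_span by blast

lemmas carrier_closed =
  subspace_0[OF subspace_carrier] subspace_add[OF subspace_carrier]
  subspace_diff[OF subspace_carrier] subspace_scale[OF subspace_carrier] mult_closed

context
  fixes g :: "'a list \<Rightarrow> 'f"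
  assumes g: "multilinear_form scale A 3 g"
begin

lemma trilinear_zero:
  assumes "x \<in> A" "y \<in> A"
  shows "g [0, x, y] = 0" "g [x, 0, y] = 0" "g [x, y, 0] = 0"
  using trilinear_scale[OF g, of 0 x y 0] trilinear_scale[OF g, of x 0 y 0]
    trilinear_scale[OF g, of x y 0 0] assms carrier_closed(1)
  by simp_all

lemma trilinear_diff_right:
  assumes "x \<in> A" "y \<in> A" "z \<in> A" "w \<in> A"
  shows "g [x, y, z - w] = g [x, y, z] - g [x, y, w]"
  using trilinear_add(3)[OF g, of x y "z - w" w] assms by (simp add: carrier_closed)

text \<open>Once the commutator is split, each of the four terms is linear in each of
  \<open>a\<close>, \<open>b\<close>, \<open>a'\<close>, \<open>b'\<close>. Bilinearity in either
  pair then follows by expanding.\<close>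

lemma S_form_eq:
  assumes "a \<in> A" "b \<in> A" "a' \<in> A" "b' \<in> A"
  shows "S_form mult g (a, b) (a', b') =
    - g [mult a a', b, b'] + g [a, mult b a', b'] + g [a, a', mult b b'] - g [a, a', mult b' b]"
  using assms by (simp add: S_form_def trilinear_diff_right carrier_closed)

lemma multilinear_form_S_form_left:
  assumes "q \<in> A \<times> A"
  shows "multilinear_form scale A 2 (\<lambda>xs. S_form mult g (xs ! 0, xs ! 1) q)"
proof -
  from assms obtain a b where q: "q = (a, b)" and "a \<in> A" "b \<in> A" by auto
  then have "multilinear_form scale A 2 (\<lambda>xs. (\<lambda>x y. S_form mult g (x, y) (a, b)) (xs ! 0) (xs ! 1))"
    by (intro multilinear_form_2I)
      (simp_all add: S_form_eq carrier_closed mult_add_left mult_add_right mult_scale_left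
        mult_scale_right trilinear_add[OF g] trilinear_scale[OF g] algebra_simps)
  then show ?thesis by (simp add: q)
qed

lemma multilinear_form_S_form_right:
  assumes "p \<in> A \<times> A"
  shows "multilinear_form scale A 2 (\<lambda>xs. S_form mult g p (xs ! 0, xs ! 1))"
proof -
  from assms obtain a b where p: "p = (a, b)" and "a \<in> A" "b \<in> A" by auto
  then have "multilinear_form scale A 2 (\<lambda>xs. (\<lambda>x y. S_form mult g (a, b) (x, y)) (xs ! 0) (xs ! 1))"
    by (intro multilinear_form_2I)
      (simp_all add: S_form_eq carrier_closed mult_add_left mult_add_right mult_scale_left
        mult_scale_right trilinear_add[OF g] trilinear_scale[OF g] algebra_simps)
  then show ?thesis by (simp add: p)
qed

text \<open>The S-expression is quadratic in the tensor: the presentation is replaced first in the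
  inner sum, by bilinearity in the second pair, and, after the sums are exchanged, in the other one,
  by bilinearity in the first pair.\<close>

lemma linear_extension_S_expression_cong:
  assumes ps: "set ps \<subseteq> A \<times> A" and qs: "set qs \<subseteq> A \<times> A"
    and eq: "tensor_class scale A 2 (formal_sum ps) = tensor_class scale A 2 (formal_sum qs)"
  shows "linear_extension g (S_expression mult ps) = linear_extension g (S_expression mult qs)"
proof -
  \<comment> \<open>The equality test in degree 2: a bilinear form has the same total over two
    presentations of one tensor.\<close>
  have *: "(\<Sum>p\<leftarrow>ps. h (fst p, snd p)) = (\<Sum>p\<leftarrow>qs. h (fst p, snd p))"
    if "multilinear_form scale A 2 (\<lambda>xs. h (xs ! 0, xs ! 1))" for h
    using eq[unfolded tensor_class_eq_iff, rule_format, OF that]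
    by (simp add: linear_extension_formal_sum case_prod_unfold)
  have left: "(\<Sum>p\<leftarrow>ps. S_form mult g p q) = (\<Sum>p\<leftarrow>qs. S_form mult g p q)" if "q \<in> A \<times> A" for q
    using *[OF multilinear_form_S_form_left[OF that]] by simp
  have right: "(\<Sum>q\<leftarrow>ps. S_form mult g p q) = (\<Sum>q\<leftarrow>qs. S_form mult g p q)" if "p \<in> A \<times> A" for p
    using *[OF multilinear_form_S_form_right[OF that]] by simp
  have "(\<Sum>p\<leftarrow>ps. \<Sum>q\<leftarrow>ps. S_form mult g p q) = (\<Sum>p\<leftarrow>ps. \<Sum>q\<leftarrow>qs. S_form mult g p q)"
    using ps by (intro arg_cong[of _ _ sum_list] map_cong refl right) auto
  also have "\<dots> = (\<Sum>q\<leftarrow>qs. \<Sum>p\<leftarrow>ps. S_form mult g p q)"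
    by (rule sum_list_swap)
  also have "\<dots> = (\<Sum>q\<leftarrow>qs. \<Sum>p\<leftarrow>qs. S_form mult g p q)"
    using qs by (intro arg_cong[of _ _ sum_list] map_cong refl left) auto
  also have "\<dots> = (\<Sum>p\<leftarrow>qs. \<Sum>q\<leftarrow>qs. S_form mult g p q)"
    by (rule sum_list_swap)
  finally show ?thesis by (simp add: linear_extension_S_expression)
qed

end

text \<open>By independence of the presentation, one convenient choice \<open>qs\<close> decides the
  equation for all of them.\<close>

lemma S_equationI:
  assumes qs: "set qs \<subseteq> A \<times> A"
    and zero: "\<And>g. multilinear_form scale A 3 g \<Longrightarrow> linear_extension g (S_expression mult qs) = 0"
  shows "S_equation scale A mult (tensor_class scale A 2 (formal_sum qs))"
  unfolding S_equation_def
proof (intro conjI allI impI)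
  have "Poly_Mapping.keys (formal_sum qs :: 'a list \<Rightarrow>\<^sub>0 'f) \<subseteq> {xs. length xs = 2 \<and> set xs \<subseteq> A}"
    using keys_formal_sum[of qs] qs by (force simp: case_prod_unfold)
  then show "tensor_class scale A 2 (formal_sum qs) \<in> tensor_power scale A 2"
    unfolding tensor_power_def by blast
next
  fix ps assume "set ps \<subseteq> A \<times> A \<and>
    tensor_class scale A 2 (formal_sum qs) = tensor_class scale A 2 (formal_sum ps)"
  then show "tensor_class scale A 3 (S_expression mult ps) = tensor_class scale A 3 0"
    using linear_extension_S_expression_cong[of _ qs ps] qs zero
    by (simp add: tensor_class_eq_iff linear_extension_zero)
qed

end

section \<open>The semidirect left-symmetric algebra and dual bases\<close>

lemma dual_space_iff:
  fixes scaleV :: "'f::field \<Rightarrow> 'v::ab_group_add \<Rightarrow> 'v"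
  assumes "vector_space scaleV"
  shows "f \<in> dual_space scaleV \<longleftrightarrow>
    (\<forall>u v. f (u + v) = f u + f v) \<and> (\<forall>c v. f (scaleV c v) = c * f v)"
  unfolding dual_space_def Vector_Spaces.linear_iff mem_Collect_eq
  by (simp only: vector_space_field assms simp_thms)

locale O_operator_basis = O_operator scaleG bracket scaleV \<rho> T
    + W: finite_dimensional_vector_space scaleV B
  for scaleG :: "'f::field \<Rightarrow> 'g::ab_group_add \<Rightarrow> 'g"
    and bracket :: "'g \<Rightarrow> 'g \<Rightarrow> 'g"
    and scaleV :: "'f \<Rightarrow> 'v::ab_group_add \<Rightarrow> 'v"
    and \<rho> :: "'g \<Rightarrow> 'v \<Rightarrow> 'v"
    and T :: "'v \<Rightarrow> 'g"
    and B :: "'v set"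
begin

interpretation T: Vector_Spaces.linear scaleV scaleG T
  by (rule linear_T)

interpretation rho: Vector_Spaces.linear scaleV scaleV "\<rho> x" for x
  by (rule linear_endo)

interpretation rho_left: Vector_Spaces.linear scaleG scaleV "\<lambda>x. \<rho> x v" for v
  by (rule linear_rep)

abbreviation "D \<equiv> dual_space scaleV"
abbreviation "d \<equiv> dual_vector scaleV B"
abbreviation "A \<equiv> semidirect_carrier scaleV T"
abbreviation "sc \<equiv> semidirect_scale scaleG :: 'f \<Rightarrow> 'g \<times> ('v \<Rightarrow> 'f) \<Rightarrow> _"
abbreviation "smult \<equiv> semidirect_mult \<rho> T :: 'g \<times> ('v \<Rightarrow> 'f) \<Rightarrow> _"

lemmas dual_iff = dual_space_iff[OF V.vector_space_axioms]

lemma dual_vector_in_dual: "d b \<in> D"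
  unfolding dual_iff dual_vector_def
  using V.representation_add[OF W.independent_Basis] V.representation_scale[OF W.independent_Basis]
  by (auto simp only: W.span_Basis UNIV_I)

lemma basis_expansion: "(\<Sum>b\<in>B. scaleV (d b v) b) = v"
  unfolding dual_vector_def
  by (rule V.sum_representation_eq[OF W.independent_Basis _ W.finite_Basis subset_refl])
    (simp only: W.span_Basis UNIV_I)

lemma dual_sum:
  assumes "f \<in> D"
  shows "f (\<Sum>i\<in>I. scaleV (k i) (u i)) = (\<Sum>i\<in>I. k i * f (u i))"
proof -
  interpret f: Vector_Spaces.linear scaleV "(*)" f
    using assms by (simp add: dual_space_def)
  show ?thesis by (simp only: f.sum f.scale)
qed

text \<open>Apply \<open>f\<close> to the basis expansion of \<open>v\<close>; the coordinates of
  \<open>f\<close> in the dual basis are its values on \<open>B\<close>.\<close>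

lemma dual_expansion:
  assumes "f \<in> D" shows "f v = (\<Sum>b\<in>B. f b * d b v)"
  using dual_sum[OF assms, where I = B, of "\<lambda>b. d b v" "\<lambda>b. b"]
  by (simp add: basis_expansion mult.commute)

lemma dual_rep_in_dual: "f \<in> D \<Longrightarrow> dual_rep \<rho> x f \<in> D"
  by (simp add: dual_iff dual_rep_def rho.add rho.scale algebra_simps)

lemma dual_closed:
  "0 \<in> D" "f \<in> D \<Longrightarrow> h \<in> D \<Longrightarrow> f + h \<in> D" "f \<in> D \<Longrightarrow> (\<lambda>v. c * f v) \<in> D"
  by (simp_all add: dual_iff algebra_simps)

lemma semidirect_carrier_iff: "(x, f) \<in> A \<longleftrightarrow> x \<in> range T \<and> f \<in> D"
  by (simp add: semidirect_carrier_def)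

lemma semidirect_mult_eq:
  "smult (T u, f) (T v, h) = (T (\<rho> (T u) v), dual_rep \<rho> (T u) h)"
  by (simp add: semidirect_mult_def O_product_eq)

text \<open>By the O-identity the commutator of the product on T(V) is the Lie bracket, and
  \<open>\<rho>\<close> respects brackets. Both components of left-symmetry reduce to this
  identity.\<close>

lemma rho_O_commutator:
  "\<rho> (T (\<rho> (T u) v)) w - \<rho> (T (\<rho> (T v) u)) w = \<rho> (T u) (\<rho> (T v) w) - \<rho> (T v) (\<rho> (T u) w)"
  using rep_bracket[of "T u" "T v" w] by (simp add: O_identity T.diff rho_left.diff)

lemma vector_space_semidirect: "vector_space sc"
  by unfold_locales (auto simp: semidirect_scale_def fun_eq_iff distrib_left distrib_right
      mult.assoc scale_right_distrib scale_left_distrib)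

interpretation A: vector_space sc
  by (rule vector_space_semidirect)

lemma subspace_semidirect: "A.subspace A"
proof (rule A.subspaceI)
  show "0 \<in> A"
    using rangeI[of T 0] by (simp add: zero_prod_def semidirect_carrier_iff dual_closed T.zero)
next
  fix x y assume "x \<in> A" "y \<in> A"
  then obtain u f v h where "x = (T u, f)" "y = (T v, h)" "f \<in> D" "h \<in> D"
    by (auto simp: semidirect_carrier_def)
  then show "x + y \<in> A"
    using rangeI[of T "u + v"] by (simp add: semidirect_carrier_iff dual_closed T.add)
next
  fix c x assume "x \<in> A"
  then obtain u f where "x = (T u, f)" "f \<in> D"
    by (auto simp: semidirect_carrier_def)
  then show "sc c x \<in> A"
    using rangeI[of T "scaleV c u"]
    by (simp add: semidirect_carrier_iff semidirect_scale_def dual_closed T.scale)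
qed

lemma sum_fun_apply: "(\<Sum>i\<in>I. f i) x = (\<Sum>i\<in>I. f i x)"
  by (induction I rule: infinite_finite_induct) simp_all

lemma semidirect_sum_Pair: "(\<Sum>i\<in>I. (x i, f i)) = (\<Sum>i\<in>I. x i, \<Sum>i\<in>I. f i)"
  by (induction I rule: infinite_finite_induct) (simp_all add: zero_prod_def)

text \<open>Provides the finite spanning set required of the algebra. It need not be a basis, as the
  \<open>T b\<close> may be dependent.\<close>

lemma span_semidirect:
  "A.span ((\<lambda>b. (T b, 0)) ` B \<union> (\<lambda>b. (0, d b)) ` B) = A"  (is "A.span ?S = A")
proof (rule subset_antisym)
  have "?S \<subseteq> A"
    using rangeI[of T 0]
    by (auto simp: semidirect_carrier_iff dual_closed dual_vector_in_dual T.zero)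
  then show "A.span ?S \<subseteq> A" by (rule A.span_minimal[OF _ subspace_semidirect])
next
  show "A \<subseteq> A.span ?S"
  proof
    fix x assume "x \<in> A"
    then obtain v f where x: "x = (T v, f)" and f: "f \<in> D" by (auto simp: semidirect_carrier_def)
    have v: "(\<Sum>b\<in>B. scaleG (d b v) (T b)) = T v"
      using arg_cong[OF basis_expansion[of v], of T] by (simp only: T.sum T.scale)
    have "(\<Sum>b\<in>B. (\<lambda>v. f b * d b v)) = f"
      by (rule ext) (simp only: sum_fun_apply dual_expansion[OF f, symmetric])
    moreover have "sc c (T b, 0) = (scaleG c (T b), 0)" "sc c (0, h) = (0, \<lambda>v. c * h v)" for c b h
      by (auto simp: semidirect_scale_def fun_eq_iff)
    ultimately have "x = (\<Sum>b\<in>B. sc (d b v) (T b, 0)) + (\<Sum>b\<in>B. sc (f b) (0, d b))"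
      by (simp add: x semidirect_sum_Pair v)
    also have "\<dots> \<in> A.span ?S"
      by (intro A.span_add A.span_sum A.span_scale A.span_base) auto
    finally show "x \<in> A.span ?S" .
  qed
qed

lemma left_symmetric_algebra_semidirect: "left_symmetric_algebra sc A smult"
proof
  show "\<exists>S. finite S \<and> A.span S = A"
  proof (intro exI conjI)
    show "A.span ((\<lambda>b. (T b, 0)) ` B \<union> (\<lambda>b. (0, d b)) ` B) = A" by (rule span_semidirect)
  qed (simp add: W.finite_Basis)
next
  fix x y assume "x \<in> A" "y \<in> A"
  then obtain u f v h where "x = (T u, f)" "y = (T v, h)" "h \<in> D"
    by (auto simp: semidirect_carrier_def)
  then show "smult x y \<in> A"
    by (simp add: semidirect_mult_eq semidirect_carrier_iff dual_rep_in_dual)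
next
  fix x y c assume "x \<in> A" "y \<in> A"
  then obtain u f v h where xy: "x = (T u, f)" "y = (T v, h)"
    by (auto simp: semidirect_carrier_def)
  have sc: "sc c (T u, f) = (T (scaleV c u), \<lambda>v. c * f v)" for u f
    by (simp add: semidirect_scale_def T.scale)
  show "smult (sc c x) y = sc c (smult x y)"
    using dual_iff \<open>y \<in> A\<close>
    by (simp add: xy sc semidirect_mult_eq)
      (simp add: T.scale rho_left.scale dual_rep_def semidirect_carrier_iff)
  show "smult x (sc c y) = sc c (smult x y)"
    by (simp add: xy sc semidirect_mult_eq) (simp add: rho.scale dual_rep_def)
next
  fix x y z assume "x \<in> A" "y \<in> A" "z \<in> A"
  then obtain u f v h w k where xyz: "x = (T u, f)" "y = (T v, h)" "z = (T w, k)" and k: "k \<in> D"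
    by (auto simp: semidirect_carrier_def)
  \<comment> \<open>The product formula applies to first components of the form \<open>T u\<close>,
    so sums and differences are brought back to that shape.\<close>
  have add: "(T u, f) + (T v, h) = (T (u + v), f + h)"
    and diff: "(T u, f) - (T v, h) = (T (u - v), f - h)" for u f v h
    by (simp_all add: T.add T.diff)
  have k_add: "k (a + b) = k a + k b" for a b
    using k by (simp add: dual_iff)
  then have k_diff: "k (a - b) = k a - k b" for a b
    by (metis add_diff_cancel_right' diff_add_cancel)
  show "smult (x + y) z = smult x z + smult y z"
    unfolding xyz add semidirect_mult_eq
    by (simp add: T.add rho_left.add dual_rep_def k_add fun_eq_iff)
  show "smult x (y + z) = smult x y + smult x z"
    unfolding xyz add semidirect_mult_eq
    by (simp add: rho.add dual_rep_def fun_eq_iff)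
  have "\<rho> (T (\<rho> (T u) v)) w - \<rho> (T u) (\<rho> (T v) w) = \<rho> (T (\<rho> (T v) u)) w - \<rho> (T v) (\<rho> (T u) w)"
    using rho_O_commutator[of u v w] by (simp add: algebra_simps)
  \<comment> \<open>Two applications of the dual representation reverse the order of the operators
    and cancel their signs, while a single one contributes a minus. The claim is thus
    \<open>k\<close> applied to the commutator identity at \<open>a\<close>.\<close>
  moreover have "dual_rep \<rho> (T (\<rho> (T u) v)) k - dual_rep \<rho> (T u) (dual_rep \<rho> (T v) k) =
      dual_rep \<rho> (T (\<rho> (T v) u)) k - dual_rep \<rho> (T v) (dual_rep \<rho> (T u) k)"
  proof
    fix a
    have "k (\<rho> (T (\<rho> (T u) v)) a) - k (\<rho> (T (\<rho> (T v) u)) a) =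
        k (\<rho> (T u) (\<rho> (T v) a)) - k (\<rho> (T v) (\<rho> (T u) a))"
      by (simp only: k_diff[symmetric] rho_O_commutator)
    then show "(dual_rep \<rho> (T (\<rho> (T u) v)) k - dual_rep \<rho> (T u) (dual_rep \<rho> (T v) k)) a =
        (dual_rep \<rho> (T (\<rho> (T v) u)) k - dual_rep \<rho> (T v) (dual_rep \<rho> (T u) k)) a"
      by (simp add: dual_rep_def algebra_simps)
  qed
  ultimately show "smult (smult x y) z - smult x (smult y z) = smult (smult y x) z - smult y (smult x z)"
    unfolding xyz semidirect_mult_eq diff by simp
qed

text \<open>In the dual basis, \<open>dual_rep \<rho> x (d b)\<close> has coordinates
  \<open>- d b (\<rho> x c)\<close>. After the sums over \<open>b\<close> and \<open>c\<close> are
  exchanged, the same numbers are the coordinates of \<open>\<rho> x c\<close> in \<open>B\<close>,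
  and linearity of \<open>h\<close> in its first argument reassembles that vector. Linearity is
  asked only for functionals in \<open>D\<close>, since the trilinear forms to be inserted are
  controlled only on the carrier.\<close>

lemma sum_dual_rep:
  assumes add: "\<And>u v f. f \<in> D \<Longrightarrow> h (u + v) f = h u f + h v f"
    and scale: "\<And>c v f. f \<in> D \<Longrightarrow> h (scaleV c v) f = c * h v f"
    and add': "\<And>v f k. f \<in> D \<Longrightarrow> k \<in> D \<Longrightarrow> h v (f + k) = h v f + h v k"
    and scale': "\<And>c v f. f \<in> D \<Longrightarrow> h v (\<lambda>u. c * f u) = c * h v f"
  shows "(\<Sum>b\<in>B. h b (dual_rep \<rho> x (d b))) = - (\<Sum>b\<in>B. h (\<rho> x b) (d b))"
proof -
  have sum: "h (\<Sum>i\<in>I. scaleV (k i) (u i)) f = (\<Sum>i\<in>I. k i * h (u i) f)" if "f \<in> D"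
    for f k u and I :: "'v set"
  proof -
    have "Vector_Spaces.linear scaleV (*) (\<lambda>v. h v f)"
      unfolding Vector_Spaces.linear_iff
      using that by (simp only: V.vector_space_axioms vector_space_field add scale simp_thms)
    then interpret h: Vector_Spaces.linear scaleV "(*)" "\<lambda>v. h v f" .
    show ?thesis by (simp only: h.sum h.scale)
  qed
  \<comment> \<open>Membership of the partial sums in \<open>D\<close> is carried through the
    induction, because additivity of \<open>h v\<close> is available only there.\<close>
  have sum': "h v (\<lambda>u. \<Sum>i\<in>I. k i * f i u) = (\<Sum>i\<in>I. k i * h v (f i)) \<and>
      (\<lambda>u. \<Sum>i\<in>I. k i * f i u) \<in> D" if "finite I" "\<And>i. f i \<in> D"
    for v k f and I :: "'v set"
    using that(1)
  proof induction
    case empty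
    show ?case using scale'[of 0 v 0] dual_closed(1) by (simp add: zero_fun_def)
  next
    case (insert i I)
    have "(\<lambda>u. \<Sum>i\<in>insert i I. k i * f i u) = (\<lambda>u. k i * f i u) + (\<lambda>u. \<Sum>i\<in>I. k i * f i u)"
      using insert by (simp add: fun_eq_iff)
    with insert that(2) show ?case by (simp add: add' scale' dual_closed)
  qed
  have "h b (dual_rep \<rho> x (d b)) = (\<Sum>c\<in>B. - d b (\<rho> x c) * h b (d c))" for b
  proof -
    have expand: "(\<lambda>v. \<Sum>c\<in>B. dual_rep \<rho> x (d b) c * d c v) = dual_rep \<rho> x (d b)"
      by (rule ext) (rule dual_expansion[OF dual_rep_in_dual[OF dual_vector_in_dual], symmetric])
    have "h b (\<lambda>v. \<Sum>c\<in>B. dual_rep \<rho> x (d b) c * d c v) = (\<Sum>c\<in>B. dual_rep \<rho> x (d b) c * h b (d c))"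
      by (rule sum'[where I = B and f = d, OF W.finite_Basis dual_vector_in_dual, THEN conjunct1])
    then show ?thesis unfolding expand by (simp only: dual_rep_def)
  qed
  then have "(\<Sum>b\<in>B. h b (dual_rep \<rho> x (d b))) = - (\<Sum>b\<in>B. \<Sum>c\<in>B. d b (\<rho> x c) * h b (d c))"
    by (simp add: sum_negf)
  also have "(\<Sum>b\<in>B. \<Sum>c\<in>B. d b (\<rho> x c) * h b (d c)) = (\<Sum>c\<in>B. \<Sum>b\<in>B. d b (\<rho> x c) * h b (d c))"
    by (rule sum.swap)
  finally have "(\<Sum>b\<in>B. h b (dual_rep \<rho> x (d b))) = - (\<Sum>c\<in>B. \<Sum>b\<in>B. d b (\<rho> x c) * h b (d c))" .
  moreover have "(\<Sum>b\<in>B. d b (\<rho> x c) * h b (d c)) = h (\<rho> x c) (d c)" for c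
    using sum[where f = "d c" and I = B and k = "\<lambda>b. d b (\<rho> x c)" and u = "\<lambda>b. b"]
    by (simp only: dual_vector_in_dual basis_expansion)
  ultimately show ?thesis by (simp only:)
qed

section \<open>Evaluation of the S-expression on dual bases\<close>

lemma in_carrier: "(T v, 0) \<in> A" "f \<in> D \<Longrightarrow> (0, f) \<in> A"
  using rangeI[of T 0] by (simp_all add: semidirect_carrier_iff dual_closed T.zero)

text \<open>These transport linear operations on V and its dual into the entries of a trilinear
  form, so that its values become bilinear functions to which \<open>sum_dual_rep\<close>
  applies.\<close>

lemma embed_simps:
  "(T (u + v), 0 :: 'v \<Rightarrow> 'f) = (T u, 0) + (T v, 0)"
  "(T (scaleV c v), 0 :: 'v \<Rightarrow> 'f) = sc c (T v, 0)"
  "(0 :: 'g, f + h :: 'v \<Rightarrow> 'f) = (0, f) + (0, h)"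
  "(0 :: 'g, (\<lambda>v. c * f v) :: 'v \<Rightarrow> 'f) = sc c (0, f)"
  by (simp_all add: T.add T.scale semidirect_scale_def fun_eq_iff)

lemma dual_rep_zero: "dual_rep \<rho> x 0 = (0 :: 'v \<Rightarrow> 'f)"
  unfolding dual_rep_def by (rule ext) simp

lemma dual_rep_zero_left:
  assumes "f \<in> D" shows "dual_rep \<rho> 0 f = 0"
proof -
  have "f (scaleV 0 0) = 0 * f 0" using assms dual_iff by blast
  then have "f 0 = 0" by simp
  then show ?thesis unfolding dual_rep_def rho_left.zero by (intro ext) simp
qed

text \<open>A dual vector has first component \<open>T 0\<close>, so it annihilates everything by
  left multiplication. This removes half of the sixteen terms in the sum below.\<close>

lemma semidirect_mult_basis:
  "smult (T u, 0) (T v, 0) = (T (\<rho> (T u) v), 0)"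
  "smult (T u, 0) (0, h) = (0, dual_rep \<rho> (T u) h)"
  "f \<in> D \<Longrightarrow> smult (0, f) (T v, 0) = 0"
  "f \<in> D \<Longrightarrow> h \<in> D \<Longrightarrow> smult (0, f) (0, h) = 0"
  using semidirect_mult_eq[of u 0 v 0] semidirect_mult_eq[of u 0 0 h]
    semidirect_mult_eq[of 0 f v 0] semidirect_mult_eq[of 0 f 0 h]
  by (simp_all add: T.zero rho.zero rho_left.zero dual_rep_zero dual_rep_zero_left zero_prod_def)

context
  fixes g :: "('g \<times> ('v \<Rightarrow> 'f)) list \<Rightarrow> 'f"
  assumes g: "multilinear_form sc A 3 g"
begin

interpretation L: left_symmetric_algebra sc A smult
  by (rule left_symmetric_algebra_semidirect)

text \<open>The four blocks record which half of the symmetric tensor each factor comes from. Moving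
  the dual representation onto the argument of \<open>T\<close> makes every surviving term one of
  \<open>X1\<close> to \<open>X4\<close> up to sign, and each of these occurs once with either sign
  after summation.\<close>

lemma sum_S_form_eq_zero:
  "(\<Sum>b\<in>B. \<Sum>c\<in>B.
      S_form smult g ((T b, 0), (0, d b)) ((T c, 0), (0, d c))
    + S_form smult g ((T b, 0), (0, d b)) ((0, d c), (T c, 0))
    + S_form smult g ((0, d b), (T b, 0)) ((T c, 0), (0, d c))
    + S_form smult g ((0, d b), (T b, 0)) ((0, d c), (T c, 0))) = 0"
proof -
  note mem = in_carrier(1) in_carrier(2)[OF dual_vector_in_dual]
    in_carrier(2)[OF dual_rep_in_dual[OF dual_vector_in_dual]]
  note lin = embed_simps trilinear_add[OF g] trilinear_scale[OF g] in_carrier dual_vector_in_dual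
  \<comment> \<open>\<open>X1\<close>, \<open>X2\<close>, \<open>X3\<close> carry the T-entry in the
    first, second and third place. \<open>X4\<close> is \<open>X3\<close> with the two dual vectors
    exchanged; as \<open>g\<close> has no symmetry, the two families cancel separately.\<close>
  define X1 where "X1 b c = g [(T (\<rho> (T b) c), 0), (0, d b), (0, d c)]" for b c
  define X2 where "X2 b c = g [(0, d b), (T (\<rho> (T b) c), 0), (0, d c)]" for b c
  define X3 where "X3 b c = g [(0, d b), (0, d c), (T (\<rho> (T b) c), 0)]" for b c
  define X4 where "X4 b c = g [(0, d c), (0, d b), (T (\<rho> (T b) c), 0)]" for b c
  have s1: "S_form smult g ((T b, 0), (0, d b)) ((T c, 0), (0, d c)) = - X1 b c" for b c
    by (simp add: L.S_form_eq[OF g] mem semidirect_mult_basis dual_vector_in_dual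
        L.trilinear_zero[OF g] X1_def)
  have s2: "S_form smult g ((T b, 0), (0, d b)) ((0, d c), (T c, 0)) =
      - g [(0, dual_rep \<rho> (T b) (d c)), (0, d b), (T c, 0)]
      - g [(T b, 0), (0, d c), (0, dual_rep \<rho> (T c) (d b))]" for b c
    by (simp add: L.S_form_eq[OF g] mem semidirect_mult_basis dual_vector_in_dual
        L.trilinear_zero[OF g])
  have s3: "S_form smult g ((0, d b), (T b, 0)) ((T c, 0), (0, d c)) =
      X2 b c + g [(0, d b), (T c, 0), (0, dual_rep \<rho> (T b) (d c))]" for b c
    by (simp add: L.S_form_eq[OF g] mem semidirect_mult_basis dual_vector_in_dual
        L.trilinear_zero[OF g] X2_def)
  have s4: "S_form smult g ((0, d b), (T b, 0)) ((0, d c), (T c, 0)) =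
      g [(0, d b), (0, dual_rep \<rho> (T b) (d c)), (T c, 0)] + X3 b c - X4 c b" for b c
    by (simp add: L.S_form_eq[OF g] mem semidirect_mult_basis dual_vector_in_dual
        L.trilinear_zero[OF g] X3_def X4_def)
  have e1: "(\<Sum>b\<in>B. g [(T b, 0), (0, d c), (0, dual_rep \<rho> (T c) (d b))]) = - (\<Sum>b\<in>B. X1 c b)" for c
    unfolding X1_def
    by (rule sum_dual_rep[of "\<lambda>v f. g [(T v, 0), (0, d c), (0, f)]"]) (simp_all only: lin)
  have e2: "(\<Sum>c\<in>B. g [(0, d b), (T c, 0), (0, dual_rep \<rho> (T b) (d c))]) = - (\<Sum>c\<in>B. X2 b c)" for b
    unfolding X2_def
    by (rule sum_dual_rep[of "\<lambda>v f. g [(0, d b), (T v, 0), (0, f)]"]) (simp_all only: lin)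
  have e3: "(\<Sum>c\<in>B. g [(0, d b), (0, dual_rep \<rho> (T b) (d c)), (T c, 0)]) = - (\<Sum>c\<in>B. X3 b c)" for b
    unfolding X3_def
    by (rule sum_dual_rep[of "\<lambda>v f. g [(0, d b), (0, f), (T v, 0)]"]) (simp_all only: lin)
  have e4: "(\<Sum>c\<in>B. g [(0, dual_rep \<rho> (T b) (d c)), (0, d b), (T c, 0)]) = - (\<Sum>c\<in>B. X4 b c)" for b
    unfolding X4_def
    by (rule sum_dual_rep[of "\<lambda>v f. g [(0, f), (0, d b), (T v, 0)]"]) (simp_all only: lin)
  \<comment> \<open>Here the dual vector acted on is paired with the outer index, so the sums are
    exchanged before \<open>e1\<close> applies.\<close>
  have e1': "(\<Sum>b\<in>B. \<Sum>c\<in>B. g [(T b, 0), (0, d c), (0, dual_rep \<rho> (T c) (d b))]) =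
      - (\<Sum>b\<in>B. \<Sum>c\<in>B. X1 b c)"
    by (subst sum.swap) (simp add: e1 sum_negf)
  \<comment> \<open>The commutator term of \<open>s4\<close> yields \<open>X4\<close> with its
    indices interchanged.\<close>
  have e4': "(\<Sum>b\<in>B. \<Sum>c\<in>B. X4 c b) = (\<Sum>b\<in>B. \<Sum>c\<in>B. X4 b c)"
    by (rule sum.swap)
  show ?thesis
    by (simp add: s1 s2 s3 s4 sum.distrib sum_subtractf sum_negf e1' e2 e3 e4 e4')
qed

end

section \<open>Symmetry and the S-equation for the sum of the tensor and its flip\<close>

lemma semidirect_tensor:
  fixes r
  defines "r \<equiv> operator_tensor scaleG scaleV B T + tensor_flip (operator_tensor scaleG scaleV B T)"
  shows tensor_flip_operator_tensor: "tensor_flip r = r"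
    and S_equation_operator_tensor: "S_equation sc A smult r"
proof -
  let ?t = "\<Sum>b\<in>B. monomial [(T b, 0), (0, d b)] :: _ \<Rightarrow>\<^sub>0 'f"
  have rev_sum: "Poly_Mapping.map_key rev (\<Sum>b\<in>I. h b) = (\<Sum>b\<in>I. Poly_Mapping.map_key rev (h b))"
    for I :: "'v set" and h :: "'v \<Rightarrow> ('g \<times> ('v \<Rightarrow> 'f)) list \<Rightarrow>\<^sub>0 'f"
    using inj_on_rev[of UNIV]
    by (induction I rule: infinite_finite_induct) (simp_all add: map_key_plus map_key_zero)
  \<comment> \<open>Passing to representatives shows the symmetry: reversal is an additive
    involution, so it only swaps the two summands.\<close>
  have r: "r = tensor_class sc A 2 (?t + Poly_Mapping.map_key rev ?t)"
    by (simp add: r_def operator_tensor_def tensor_flip_tensor_class tensor_class_add)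
  show "tensor_flip r = r"
    using inj_on_rev[of UNIV]
    by (simp add: r tensor_flip_tensor_class map_key_plus map_key_rev_rev add.commute)
  obtain bs where bs: "set bs = B" "distinct bs"
    using finite_distinct_list[OF W.finite_Basis] by blast
  \<comment> \<open>An explicit presentation of \<open>r\<close>. Since \<open>bs\<close> lists
    \<open>B\<close> without repetition, sums over \<open>qs\<close> become sums over the
    basis.\<close>
  define qs :: "(('g \<times> ('v \<Rightarrow> 'f)) \<times> ('g \<times> ('v \<Rightarrow> 'f))) list" where
    "qs = map (\<lambda>b. ((T b, 0), (0, d b))) bs @ map (\<lambda>b. ((0, d b), (T b, 0))) bs"
  have sum_qs: "(\<Sum>q\<leftarrow>qs. F q) = (\<Sum>b\<in>B. F ((T b, 0), (0, d b)) + F ((0, d b), (T b, 0)))"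
    for F :: "_ \<Rightarrow> 'z::comm_monoid_add"
    using bs by (simp add: qs_def o_def sum_list_distinct_conv_sum_set sum.distrib)
  have "formal_sum qs = ?t + Poly_Mapping.map_key rev ?t"
    by (simp add: formal_sum_def sum_qs rev_sum map_key_rev_monomial sum.distrib)
  moreover have "S_equation sc A smult (tensor_class sc A 2 (formal_sum qs))"
  proof (rule left_symmetric_algebra.S_equationI[OF left_symmetric_algebra_semidirect])
    show "set qs \<subseteq> A \<times> A"
      by (auto simp: qs_def in_carrier dual_vector_in_dual)
    fix g assume "multilinear_form sc A 3 g"
    from sum_S_form_eq_zero[OF this]
    show "linear_extension g (S_expression smult qs) = 0"
      by (simp add: linear_extension_S_expression sum_qs sum.distrib add_ac)
  qed
  ultimately show "S_equation sc A smult r" by (simp add: r)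
qed

end

theorem theorem6p9:
  fixes scaleG :: "'f::field \<Rightarrow> 'g::ab_group_add \<Rightarrow> 'g"
    and bracket :: "'g \<Rightarrow> 'g \<Rightarrow> 'g"
    and scaleV :: "'f \<Rightarrow> 'v::ab_group_add \<Rightarrow> 'v"
    and \<rho> :: "'g \<Rightarrow> 'v \<Rightarrow> 'v"
    and T :: "'v \<Rightarrow> 'g"
    and B :: "'v set"
  assumes "lie_algebra scaleG bracket"
    and "finite_dimensional_vector_space scaleV B"
    and "lie_representation scaleG bracket scaleV \<rho>"
    and "O_operator scaleG bracket scaleV \<rho> T"
  shows "let A = semidirect_carrier scaleV T;
             sc = semidirect_scale scaleG;
             r = operator_tensor scaleG scaleV B T
                   + tensor_flip (operator_tensor scaleG scaleV B T)
         in left_symmetric_algebra sc A (semidirect_mult \<rho> T)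
            \<and> tensor_flip r = r
            \<and> S_equation sc A (semidirect_mult \<rho> T) r"
proof -
  interpret O_operator_basis scaleG bracket scaleV \<rho> T B
    using assms by (intro O_operator_basis.intro)
  show ?thesis
    using left_symmetric_algebra_semidirect tensor_flip_operator_tensor S_equation_operator_tensor
    by (simp add: Let_def)
qed

end
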